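(* Let $k\ge1$ and let $\mathfrak{S}_k=(X,Y,E)$ be the bipartite graph with $X=[k]$, $Y=\{S\subseteq[k]: S\neq\emptyset\}$, and $E=\{(x,S): x\in S\}$. Then $\mathfrak{S}_k$ is constructible by conditioning using $2(k-1)$ doublings.
   Context: A bipartite graph $(X,Y,E)$ with $E\subseteq X\times Y$ is viewed as a 2-partite hypergraph. A homomorphism $(X,Y,E)\to(X',Y',E')$ is a pair of maps $X\to X'$, $Y\to Y'$ mapping edges to edges. For $X_0\subseteq X,Y_0\subseteq Y$ the induced subgraph is $(X_0,Y_0,E\cap(X_0\times Y_0))$. Constructible by conditioning (recursively, up to renaming of vertices); a construction is a sequence of operations starting from a single edge, and its number of doublings is the number of operations of type (2): (1) A single edge is constructible. (2) Doubling: given a constructible graph whose vertices are partitioned into "fixed" and "old" vertices, add for every old vertex $q$ a fresh copy $q'$ on the same side, and for every edge $e$ not both of whose endpoints are fixed add the edge $e'$ obtained by replacing each old endpoint by its copy; the result is constructible. (3) Collapse: if $H$ is constructible, $H_0$ is an induced subgraph of $H$, and some homomorphism $H\to H_0$ is the identity on the vertices of $H_0$, then $H_0$ is constructible. *)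

theory Defs
  imports Main "HOL-Library.FuncSet"
begin

record ('a, 'b) bigraph =
  lverts :: "'a set"
  rverts :: "'b set"
  edges  :: "('a \<times> 'b) set"

abbreviation mk_bigraph :: "'a set \<Rightarrow> 'b set \<Rightarrow> ('a \<times> 'b) set \<Rightarrow> ('a, 'b) bigraph" where
  "mk_bigraph X Y E \<equiv> \<lparr>lverts = X, rverts = Y, edges = E\<rparr>"

definition wf_bigraph :: "('a, 'b) bigraph \<Rightarrow> bool" where
  "wf_bigraph G \<longleftrightarrow> edges G \<subseteq> lverts G \<times> rverts G"

definition bigraph_hom ::
  "('a \<Rightarrow> 'c) \<Rightarrow> ('b \<Rightarrow> 'd) \<Rightarrow> ('a, 'b) bigraph \<Rightarrow> ('c, 'd) bigraph \<Rightarrow> bool" where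
  "bigraph_hom f g G H \<longleftrightarrow>
     f \<in> lverts G \<rightarrow> lverts H \<and> g \<in> rverts G \<rightarrow> rverts H \<and>
     (\<forall>(x, y) \<in> edges G. (f x, g y) \<in> edges H)"

definition bigraph_iso :: "('a, 'b) bigraph \<Rightarrow> ('c, 'd) bigraph \<Rightarrow> bool" where
  "bigraph_iso G H \<longleftrightarrow>
     (\<exists>f g. bij_betw f (lverts G) (lverts H) \<and> bij_betw g (rverts G) (rverts H) \<and>
        (\<forall>x \<in> lverts G. \<forall>y \<in> rverts G. (x, y) \<in> edges G \<longleftrightarrow> (f x, g y) \<in> edges H))"

definition induced_bigraph :: "('a, 'b) bigraph \<Rightarrow> 'a set \<Rightarrow> 'b set \<Rightarrow> ('a, 'b) bigraph" where
  "induced_bigraph G X\<^sub>0 Y\<^sub>0 = mk_bigraph X\<^sub>0 Y\<^sub>0 (edges G \<inter> (X\<^sub>0 \<times> Y\<^sub>0))"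

text \<open>
  \<open>A\<close> and \<open>B\<close> are the sets of old left and right vertices (all other vertices are fixed);
  \<open>c\<close> and \<open>d\<close> assign to each old vertex its copy. Freshness of the copies is demanded where
  the operation is used, in \<open>constr\<close> below.
\<close>

definition doubling ::
  "('a, 'b) bigraph \<Rightarrow> 'a set \<Rightarrow> 'b set \<Rightarrow> ('a \<Rightarrow> 'a) \<Rightarrow> ('b \<Rightarrow> 'b) \<Rightarrow> ('a, 'b) bigraph" where
  "doubling G A B c d =
     mk_bigraph (lverts G \<union> c ` A) (rverts G \<union> d ` B)
       (edges G \<union>
        {(if x \<in> A then c x else x, if y \<in> B then d y else y) | x y.
           (x, y) \<in> edges G \<and> (x \<in> A \<or> y \<in> B)})"

text \<open>
  \<open>constr n G\<close>: some construction with exactly \<open>n\<close> doublings yields \<open>G\<close>. Since every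
  constructible graph is finite, it suffices to name vertices by natural numbers, among which
  fresh copies always exist; the two sides are named independently. Renaming, in particular
  to arbitrary vertex types, is added in \<open>constructible\<close>. No generality is lost by renaming
  only at the end, because the names in \<open>single_edge\<close> and \<open>double\<close> are arbitrary.
\<close>

inductive constr :: "nat \<Rightarrow> (nat, nat) bigraph \<Rightarrow> bool" where
  single_edge: "constr 0 (mk_bigraph {x} {y} {(x, y)})"
| double: "constr (Suc n) (doubling G A B c d)"
    if "constr n G"
      "A \<subseteq> lverts G" "inj_on c A" "c ` A \<inter> lverts G = {}"
      "B \<subseteq> rverts G" "inj_on d B" "d ` B \<inter> rverts G = {}"
| collapse: "constr n (induced_bigraph G X\<^sub>0 Y\<^sub>0)"
    if "constr n G"
      "X\<^sub>0 \<subseteq> lverts G" "Y\<^sub>0 \<subseteq> rverts G"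
      "bigraph_hom f g G (induced_bigraph G X\<^sub>0 Y\<^sub>0)"
      "\<forall>x \<in> X\<^sub>0. f x = x" "\<forall>y \<in> Y\<^sub>0. g y = y"

definition constructible :: "nat \<Rightarrow> ('a, 'b) bigraph \<Rightarrow> bool" where
  "constructible n G \<longleftrightarrow> wf_bigraph G \<and> (\<exists>H. constr n H \<and> bigraph_iso H G)"

definition subset_graph :: "nat \<Rightarrow> (nat, nat set) bigraph" where
  "subset_graph k =
     mk_bigraph {1..k} {S. S \<subseteq> {1..k} \<and> S \<noteq> {}}
       {(x, S). S \<subseteq> {1..k} \<and> x \<in> S}"

end

theory Submission
  imports Defs "HOL-Library.Nat_Bijection"
begin

text \<open>
  The graph for \<open>k + 1\<close> arises from the graph for \<open>k\<close> by two doublings and no collapse. First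
  double the right vertices \<open>S\<close> containing \<open>k\<close>, everything else being fixed, and call the copy
  \<open>S \<union> {k + 1}\<close>. Then double \<open>k\<close> together with the original sets \<open>S\<close> containing \<open>k\<close>, calling the
  copies \<open>k + 1\<close> and \<open>(S - {k}) \<union> {k + 1}\<close>: the fixed vertices \<open>S \<union> {k + 1}\<close> become adjacent to
  \<open>k + 1\<close>. With these names every graph on the way is an incidence graph between numbers and sets.
\<close>

text \<open>\<open>constr\<close> names vertices by numbers, so sets enter through their codes.
  Members of \<open>F\<close> may contain elements outside \<open>X\<close>, which give no edges: a
  set can carry its final name before all of its elements are left vertices.\<close>

definition incidence :: "nat set \<Rightarrow> nat set set \<Rightarrow> (nat, nat) bigraph" where
  "incidence X F =
     mk_bigraph X (set_encode ` F) {(x, set_encode S) | x S. S \<in> F \<and> x \<in> X \<inter> S}"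

lemma incidence_simps [simp]:
  "lverts (incidence X F) = X"
  "rverts (incidence X F) = set_encode ` F"
  "edges (incidence X F) = {(x, set_encode S) | x S. S \<in> F \<and> x \<in> X \<inter> S}"
  by (simp_all add: incidence_def)

text \<open>An old set is never joined to the copy of a left vertex, while its own copy sees the
  fixed neighbours and the copies of the old ones; this is \<open>old\<close>. A fixed set gains
  \<open>c x\<close> for each old neighbour \<open>x\<close>; this is \<open>kept\<close>.\<close>

lemma doubling_incidence:
  assumes fin: "\<forall>S \<in> F. finite S" and "A \<subseteq> X" and "B \<subseteq> F"
    and old: "\<forall>S \<in> B. S \<inter> c ` A = {} \<and> d S \<inter> (X \<union> c ` A) = (S \<inter> X - A) \<union> c ` (S \<inter> A)"
    and kept: "\<forall>S \<in> F - B. S \<inter> c ` A = c ` (S \<inter> A)"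
  shows "doubling (incidence X F) A (set_encode ` B) c (set_encode \<circ> d \<circ> set_decode)
       = incidence (X \<union> c ` A) (F \<union> d ` B)"
proof -
  let ?d = "set_encode \<circ> d \<circ> set_decode"
  have d: "?d (set_encode S) = set_encode (d S)" if "S \<in> F" for S
    using that fin by simp
  have dB: "?d ` set_encode ` B = set_encode ` d ` B"
    using d \<open>B \<subseteq> F\<close> by (auto simp: image_image subset_iff simp del: comp_apply)
  have mem: "set_encode S \<in> set_encode ` B \<longleftrightarrow> S \<in> B" if "S \<in> F" for S
    using that fin \<open>B \<subseteq> F\<close> by (metis image_eqI imageE set_encode_inverse subsetD)
  define move where "move x y = (if x \<in> A then c x else x, if y \<in> set_encode ` B then ?d y else y)" for x y
  define new where "new = {move x y | x y. (x, y) \<in> edges (incidence X F) \<and> (x \<in> A \<or> y \<in> set_encode ` B)}"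
  have move: "move x (set_encode S) = (if x \<in> A then c x else x, set_encode (if S \<in> B then d S else S))"
    if "S \<in> F" for x S
    using d[OF that] mem[OF that] by (simp add: move_def)
  \<comment> \<open>The added edges are parametrised by sets instead of codes, so that
    \<open>old\<close> and \<open>kept\<close> can be applied to them.\<close>
  have "new = {move x (set_encode S) | x S. S \<in> F \<and> x \<in> X \<inter> S \<and> (x \<in> A \<or> S \<in> B)}"
  proof -
    have "{move x y | x y. (x, y) \<in> edges (incidence X F) \<and> (x \<in> A \<or> y \<in> M)} =
        {move x (set_encode S) | x S. S \<in> F \<and> x \<in> X \<inter> S \<and> (x \<in> A \<or> set_encode S \<in> M)}" for M
      unfolding incidence_simps by blast
    then show ?thesis
      unfolding new_def using mem by (simp cong: conj_cong)
  qed
  also have "\<dots> = {(if x \<in> A then c x else x, set_encode (if S \<in> B then d S else S)) | x S.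
      S \<in> F \<and> x \<in> X \<inter> S \<and> (x \<in> A \<or> S \<in> B)}"
    by (intro Collect_cong ex_cong1 rev_conj_cong refl arg_cong2[where f = "(=)"]) (rule move, blast)
  finally have new_eq: "new = \<dots>" .
  have "edges (incidence X F) \<union> new = edges (incidence (X \<union> c ` A) (F \<union> d ` B))" (is "?L = ?R")
  proof (intro equalityI subsetI)
    fix e assume "e \<in> ?L"
    then show "e \<in> ?R"
    proof
      assume "e \<in> edges (incidence X F)"
      then show ?thesis by auto
    next
      assume "e \<in> new"
      then obtain x S where e: "e = (if x \<in> A then c x else x, set_encode (if S \<in> B then d S else S))"
        and S: "S \<in> F" "x \<in> X \<inter> S" "x \<in> A \<or> S \<in> B"
        unfolding new_eq by blast
      let ?x = "if x \<in> A then c x else x" and ?S = "if S \<in> B then d S else S"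
      have "?S \<in> F \<union> d ` B" "?x \<in> X \<union> c ` A"
        using S by auto
      moreover have "?x \<in> ?S"
        using S old kept by (cases "S \<in> B"; cases "x \<in> A") (simp; blast)+
      ultimately show ?thesis
        unfolding e incidence_simps by blast
    qed
  next
    fix e assume "e \<in> ?R"
    then obtain z T where e: "e = (z, set_encode T)" and T: "T \<in> F \<union> d ` B" "z \<in> X \<union> c ` A" "z \<in> T"
      by auto
    show "e \<in> ?L"
    proof (cases "T \<in> F")
      case True
      show ?thesis
      proof (cases "z \<in> X")
        case True
        then show ?thesis using e \<open>T \<in> F\<close> T by auto
      next
        case False
        \<comment> \<open>Here \<open>z\<close> is a copy, so \<open>old\<close> makes
          \<open>T\<close> fixed and \<open>kept\<close> exhibits the edge at \<open>T\<close> that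
          was copied.\<close>
        then have "z \<in> T \<inter> c ` A" using T by blast
        with old have "T \<notin> B" by blast
        with kept \<open>T \<in> F\<close> \<open>z \<in> T \<inter> c ` A\<close> obtain x where "x \<in> T \<inter> A" "z = c x" by blast
        with \<open>T \<notin> B\<close> \<open>T \<in> F\<close> \<open>A \<subseteq> X\<close> have "e \<in> new"
          unfolding new_eq e by force
        then show ?thesis by blast
      qed
    next
      case False
      with T obtain S where S: "S \<in> B" "T = d S" by blast
      with T have "z \<in> d S \<inter> (X \<union> c ` A)" by simp
      also have "\<dots> = (S \<inter> X - A) \<union> c ` (S \<inter> A)" using old S by simp
      finally have "z \<in> (S \<inter> X - A) \<union> c ` (S \<inter> A)" .
      then obtain x where "x \<in> X \<inter> S" "z = (if x \<in> A then c x else x)"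
        using \<open>A \<subseteq> X\<close> by auto
      with S \<open>B \<subseteq> F\<close> have "e \<in> new"
        unfolding new_eq e by force
      then show ?thesis by blast
    qed
  qed
  then show ?thesis
    unfolding doubling_def new_def move_def
    using dB by (simp add: incidence_def image_Un del: comp_apply)
qed

text \<open>Freshness and injectivity pass from sets to codes because \<open>set_encode\<close> is
  injective on finite sets; hence finiteness is asked of the copies as well.\<close>

lemma constr_incidence_double:
  assumes "constr n (incidence X F)"
    and fin: "\<forall>S \<in> F \<union> d ` B. finite S" and "A \<subseteq> X" and "B \<subseteq> F"
    and "inj_on c A" "c ` A \<inter> X = {}" "inj_on d B" and freshB: "d ` B \<inter> F = {}"
    and "\<forall>S \<in> B. S \<inter> c ` A = {} \<and> d S \<inter> (X \<union> c ` A) = (S \<inter> X - A) \<union> c ` (S \<inter> A)"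
    and "\<forall>S \<in> F - B. S \<inter> c ` A = c ` (S \<inter> A)"
  shows "constr (Suc n) (incidence (X \<union> c ` A) (F \<union> d ` B))"
proof -
  let ?d = "set_encode \<circ> d \<circ> set_decode"
  have inj: "inj_on set_encode (F \<union> d ` B)"
    using fin by (metis inj_onI set_encode_inverse)
  have dB: "?d (set_encode S) = set_encode (d S)" if "S \<in> B" for S
    using that fin \<open>B \<subseteq> F\<close> by auto
  have "inj_on ?d (set_encode ` B)"
  proof (rule inj_onI, clarify)
    fix S T assume *: "S \<in> B" "T \<in> B" "?d (set_encode S) = ?d (set_encode T)"
    then have "d S = d T"
      using dB inj by (metis UnI2 image_eqI inj_onD)
    with * \<open>inj_on d B\<close> show "set_encode S = set_encode T"
      by (metis inj_onD)
  qed
  moreover have "?d ` set_encode ` B = set_encode ` d ` B"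
    using dB by (auto simp: image_image simp del: comp_apply)
  moreover have "set_encode ` d ` B \<inter> set_encode ` F = {}"
    using inj_on_image_Int[OF inj, of "d ` B" F] freshB by simp
  ultimately have "constr (Suc n) (doubling (incidence X F) A (set_encode ` B) c ?d)"
    using assms by (intro constr.double) (auto simp del: comp_apply)
  then show ?thesis
    using assms by (subst (asm) doubling_incidence) auto
qed

text \<open>Counting from \<open>n = k - 1\<close> starts the induction at the single edge and
  avoids truncated subtraction.\<close>

lemma constr_incidence_subsets:
  "constr (2 * n) (incidence {1..Suc n} (Pow {1..Suc n} - {{}}))"
proof (induction n)
  case 0
  have "incidence {1..Suc 0} (Pow {1..Suc 0} - {{}}) = mk_bigraph {1} {2} {(1, 2)}"
  proof -
    have "Pow {1..Suc 0} - {{}} = {{1}}" by auto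
    moreover have "set_encode {1} = 2" by (simp add: set_encode_def)
    ultimately show ?thesis by (auto simp: incidence_def)
  qed
  then show ?case using constr.single_edge[of 1 2] by simp
next
  case (Suc n)
  define k where "k = Suc n"
  define P where "P = Pow {1..k} - {{}}"
  define B where "B = {S \<in> P. k \<in> S}"
  define both where "both = insert (Suc k) ` B"
  define only where "only = (\<lambda>S. insert (Suc k) (S - {k}))"
  have P: "finite S" "Suc k \<notin> S" if "S \<in> P" for S
    using that finite_subset[of S "{1..k}"] by (auto simp: P_def)
  \<comment> \<open>No left vertex is old, so \<open>id\<close> is a dummy. As \<open>Suc k\<close>
    is not yet a left vertex, each copy has the same neighbours as its original.\<close>
  have "constr (Suc (2 * n)) (incidence ({1..k} \<union> id ` {}) (P \<union> both))"
    unfolding both_def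
  proof (rule constr_incidence_double)
    show "constr (2 * n) (incidence {1..k} P)"
      using Suc by (simp add: k_def P_def)
    show "inj_on (insert (Suc k)) B"
      using P(2) by (intro inj_onI) (simp add: B_def insert_ident)
  qed (use P B_def in auto)
  then have one: "constr (Suc (2 * n)) (incidence {1..k} (P \<union> both))"
    by simp
  \<comment> \<open>The fixed sets contain both \<open>k\<close> and \<open>Suc k\<close> (those in
    \<open>both\<close>) or neither (those in \<open>P - B\<close>), which is what
    \<open>kept\<close> requires.\<close>
  have "constr (Suc (Suc (2 * n))) (incidence ({1..k} \<union> Suc ` {k}) (P \<union> both \<union> only ` B))"
  proof (rule constr_incidence_double[OF one])
    show "inj_on only B"
    proof (rule inj_onI)
      fix S T assume *: "S \<in> B" "T \<in> B" "only S = only T"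
      have "S = insert k (only S - {Suc k})" "T = insert k (only T - {Suc k})"
        using *(1,2) P(2) by (auto simp: only_def B_def)
      then show "S = T" using * by simp
    qed
    \<comment> \<open>Containing \<open>Suc k\<close> separates the new copies from
      \<open>P\<close>, and lacking \<open>k\<close> separates them from
      \<open>both\<close>.\<close>
    have "k \<notin> only S" "Suc k \<in> only S" for S
      by (auto simp: only_def)
    moreover have "k \<in> T" if "T \<in> both" for T
      using that by (auto simp: both_def B_def)
    ultimately show "only ` B \<inter> (P \<union> both) = {}"
      using P(2) by blast
  qed (use P in \<open>auto simp: only_def both_def B_def k_def\<close>)
  moreover have "P \<union> both \<union> only ` B = Pow {1..Suc k} - {{}}" (is "?L = ?R")
  proof (intro equalityI subsetI)
    fix S assume "S \<in> ?L"
    then show "S \<in> ?R"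
      by (auto simp: P_def B_def both_def only_def le_Suc_eq)
  next
    fix S assume S: "S \<in> ?R"
    show "S \<in> ?L"
    proof (cases "Suc k \<in> S")
      case False
      with S show ?thesis by (auto simp: P_def subset_iff le_Suc_eq)
    next
      case True
      \<comment> \<open>\<open>T\<close> is the original of which \<open>S\<close> is a copy;
        whether \<open>k\<close> lies in \<open>S\<close> tells which doubling made the
        copy.\<close>
      define T where "T = insert k (S - {Suc k})"
      have "T \<in> B"
        using S by (auto simp: T_def B_def P_def k_def subset_iff le_Suc_eq)
      moreover have "S = insert (Suc k) T" if "k \<in> S"
        using that True by (auto simp: T_def)
      moreover have "S = only T" if "k \<notin> S"
        using that True by (auto simp: T_def only_def)
      ultimately show ?thesis by (auto simp: both_def)
    qed
  qed
  moreover have "{1..k} \<union> Suc ` {k} = {1..Suc k}"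
    by auto
  ultimately show ?case
    by (simp add: k_def)
qed

theorem theorem8p4:
  fixes k :: nat
  assumes "k \<ge> 1"
  shows "constructible (2 * (k - 1)) (subset_graph k)"
proof -
  define P where "P = Pow {1..k} - {{}}"
  have dec: "set_decode (set_encode S) = S" if "S \<in> P" for S
    using that finite_subset[of S "{1..k}"] by (auto simp: P_def)
  have subset_graph_eq: "subset_graph k = mk_bigraph {1..k} P {(x, S). S \<subseteq> {1..k} \<and> x \<in> S}"
    by (auto simp: subset_graph_def P_def)
  have "bij_betw set_decode (set_encode ` P) P"
    using dec by (intro bij_betw_byWitness[of _ set_encode]) auto
  moreover have "(x, set_encode S) \<in> edges (incidence {1..k} P) \<longleftrightarrow> S \<subseteq> {1..k} \<and> x \<in> S"
    if "x \<in> {1..k}" "S \<in> P" for x S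
  proof -
    have "S \<subseteq> {1..k}" using that by (simp add: P_def)
    \<comment> \<open>The set witnessing an edge of \<open>incidence\<close> is determined by its
      code.\<close>
    moreover have "T = S" if "set_encode S = set_encode T" "T \<in> P" for T
      using that \<open>S \<in> P\<close> dec by metis
    ultimately show ?thesis using that by auto
  qed
  ultimately have "bigraph_iso (incidence {1..k} P) (subset_graph k)"
    unfolding bigraph_iso_def subset_graph_eq using dec
    by (intro exI[of _ id] exI[of _ set_decode]) (auto simp del: incidence_simps(3))
  moreover have "constr (2 * (k - 1)) (incidence {1..k} P)"
    using constr_incidence_subsets[of "k - 1"] assms by (simp add: P_def)
  moreover have "wf_bigraph (subset_graph k)"
    by (auto simp: wf_bigraph_def subset_graph_def)
  ultimately show ?thesis
    unfolding constructible_def by blast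
qed

end
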